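(* Let $d$ and $s$ be constants, let $A\subseteq\mathbb{R}^d$ be a Delone set with constants $0<r<R<\infty$, let $\sigma=\{0,1,\ldots,s\}$, let $\chi\colon A\to\sigma$ be a random coloring, and let $\Omega$ be the closed ball of radius $\omega>R$ centered at the origin. Writing $n=|A\cap\Omega|$ and $A_j=\chi^{-1}(j)$, the expected number of cells of the overlay $\mathrm{Ovl}\{\mathrm{Vor}(A_j): j\in\sigma\}$ that have at least one vertex in $\Omega$ is $O(n)$, with implied constant depending only on $d,s,r,R$.
   Context: $A$ is a Delone set with constants $0<r<R<\infty$ if every open ball of radius $r$ contains at most one point of $A$ and every closed ball of radius $R$ contains at least one point of $A$. A random coloring assigns colors from $\sigma$ to points independently and uniformly at random. $\mathrm{Vor}(A_j)$ is the Voronoi tessellation of the (locally finite) set $A_j$. The overlay is the decomposition of $\mathbb{R}^d$ whose $d$-cells are the intersections $\nu_0\cap\cdots\cap\nu_s$ with non-empty interior, $\nu_j$ a Voronoi domain of $A_j$, together with all their faces. *)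

theory Defs
  imports "HOL-Probability.Probability"
begin

definition delone :: "real \<Rightarrow> real \<Rightarrow> 'a::metric_space set \<Rightarrow> bool" where
  "delone r R A \<longleftrightarrow>
     (\<forall>x. \<forall>p\<in>A \<inter> ball x r. \<forall>q\<in>A \<inter> ball x r. p = q) \<and>
     (\<forall>x. A \<inter> cball x R \<noteq> {})"

definition voronoi_domain :: "'a::metric_space set \<Rightarrow> 'a \<Rightarrow> 'a set" where
  "voronoi_domain B a = {x. \<forall>b\<in>B. dist x a \<le> dist x b}"

text \<open>The tessellation is represented by its set of domains, which determine all lower-dimensional
  cells; in particular the empty set has the empty tessellation.\<close>

definition Vor :: "'a::metric_space set \<Rightarrow> 'a set set" where
  "Vor B = voronoi_domain B ` B"

definition overlay_top_cells :: "'j set \<Rightarrow> ('j \<Rightarrow> 'a::euclidean_space set set) \<Rightarrow> 'a set set" where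
  "overlay_top_cells J V =
     {c. \<exists>\<nu>. (\<forall>j\<in>J. \<nu> j \<in> V j) \<and> c = (\<Inter>j\<in>J. \<nu> j) \<and> interior c \<noteq> {}}"

text \<open>The library's \<open>face_of\<close> admits the empty face, which is not a cell, and the improper
  face, which is one.\<close>

definition Ovl :: "'j set \<Rightarrow> ('j \<Rightarrow> 'a::euclidean_space set set) \<Rightarrow> 'a set set" where
  "Ovl J V = {F. F \<noteq> {} \<and> (\<exists>c\<in>overlay_top_cells J V. F face_of c)}"

definition color_class :: "'a set \<Rightarrow> ('a \<Rightarrow> 'j) \<Rightarrow> 'j \<Rightarrow> 'a set" where
  "color_class A f j = {a \<in> A. f a = j}"

definition random_coloring :: "'a set \<Rightarrow> 'j set \<Rightarrow> ('a \<Rightarrow> 'j) measure" where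
  "random_coloring A \<sigma> = PiM A (\<lambda>_. uniform_count_measure \<sigma>)"

text \<open>Vertices of a cell are its 0-dimensional faces, i.e. its extreme points
  (\<open>face_of_singleton\<close>). Counting with \<open>count_space\<close> rather than \<open>card\<close>
  makes the number of elements of an infinite set \<open>\<infinity>\<close> instead of \<open>0\<close>.\<close>

definition num_cells_with_vertex_in :: "'a::euclidean_space set \<Rightarrow> 'a set set \<Rightarrow> ennreal" where
  "num_cells_with_vertex_in \<Omega> K =
     emeasure (count_space UNIV) {F \<in> K. \<exists>v\<in>\<Omega>. v extreme_point_of F}"

end

theory Submission
  imports Defs "HOL-Real_Asymp.Real_Asymp"
begin

text \<open>For a point \<open>y\<close> let \<open>M y\<close> be the set of all sites that are nearest to \<open>y\<close> within their color
  class. A cell of the overlay is \<open>{z. S \<subseteq> M z}\<close> with \<open>S = M y\<close> for any relative interior point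
  \<open>y\<close> of it, and \<open>S\<close> can be thinned out to at most \<open>d + s + 1\<close> sites: one of each color, and enough
  others for the normals of the bisectors to keep their span. If all colors occur within distance \<open>\<tau>\<close>
  of \<open>x\<close>, the sites of a cell with a vertex in \<open>cball x (2 R)\<close> lie in \<open>cball x (\<tau> + 4 R)\<close>, so the
  number of such cells is polynomial in \<open>\<tau>\<close>, while a color is missing from \<open>cball x \<tau>\<close> with
  probability exponentially small in \<open>\<tau>\<close>. Hence this number has bounded expectation, and \<open>\<Omega>\<close> is
  covered by the balls \<open>cball a (2 R)\<close> with \<open>a \<in> A \<inter> \<Omega>\<close>. Measurability holds because the count is
  a sum of indicators over the finite sets \<open>S \<subseteq> A\<close>, and each indicator depends on the colors of
  finitely many sites once all colors have been seen.\<close>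

section \<open>Cells as sets of common nearest sites\<close>

definition nearest_sites :: "'a::metric_space set \<Rightarrow> ('a \<Rightarrow> 'j) \<Rightarrow> 'a \<Rightarrow> 'a set" where
  "nearest_sites A f y = {a \<in> A. \<forall>b\<in>A. f b = f a \<longrightarrow> dist y a \<le> dist y b}"

text \<open>One encoding serves cells of every dimension: one site per color gives an intersection
  of Voronoi domains, and each further site of a color already present forces an equality of
  distances.\<close>

definition site_cell :: "'a::metric_space set \<Rightarrow> ('a \<Rightarrow> 'j) \<Rightarrow> 'a set \<Rightarrow> 'a set" where
  "site_cell A f S = {z. S \<subseteq> nearest_sites A f z}"

text \<open>After squaring, the term \<open>z \<bullet> z\<close> cancels, so the condition on
  \<open>z\<close> is affine. Convexity, faces and the span argument all rest on this.\<close>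

lemma dist_le_iff_inner:
  fixes z p b :: "'a::real_inner"
  shows "dist z p \<le> dist z b \<longleftrightarrow> 2 * ((b - p) \<bullet> z) \<le> b \<bullet> b - p \<bullet> p"
proof -
  have "dist z p \<le> dist z b \<longleftrightarrow> (dist z p)\<^sup>2 \<le> (dist z b)\<^sup>2"
    by (simp add: power_mono_iff)
  also have "\<dots> \<longleftrightarrow> 2 * ((b - p) \<bullet> z) \<le> b \<bullet> b - p \<bullet> p"
    by (auto simp: dist_norm power2_norm_eq_inner algebra_simps inner_commute)
  finally show ?thesis .
qed

lemma dist_eq_iff_inner:
  fixes z p b :: "'a::real_inner"
  shows "dist z p = dist z b \<longleftrightarrow> 2 * ((b - p) \<bullet> z) = b \<bullet> b - p \<bullet> p"
  using dist_le_iff_inner[of z p b] dist_le_iff_inner[of z b p]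
  by (auto simp: inner_diff_left)

lemma nearest_sites_subset: "nearest_sites A f y \<subseteq> A"
  by (auto simp: nearest_sites_def)

lemma nearest_sites_le:
  "\<lbrakk>p \<in> nearest_sites A f y; b \<in> A; f b = f p\<rbrakk> \<Longrightarrow> dist y p \<le> dist y b"
  by (auto simp: nearest_sites_def)

lemma nearest_sites_dist_eq:
  "\<lbrakk>p \<in> nearest_sites A f y; q \<in> nearest_sites A f y; f p = f q\<rbrakk> \<Longrightarrow> dist y p = dist y q"
  by (auto simp: nearest_sites_def intro: antisym)

lemma nearest_sitesI:
  assumes "p \<in> nearest_sites A f y" "b \<in> A" "f b = f p" "dist y b \<le> dist y p"
  shows "b \<in> nearest_sites A f y"
  using assms unfolding nearest_sites_def by (auto intro: order_trans)

lemma convex_site_cell: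
  fixes A :: "'a::euclidean_space set"
  assumes "S \<subseteq> A"
  shows "convex (site_cell A f S)"
proof -
  have "site_cell A f S = (\<Inter>p\<in>S. \<Inter>b\<in>{b\<in>A. f b = f p}. {z. (2 *\<^sub>R (b - p)) \<bullet> z \<le> b \<bullet> b - p \<bullet> p})"
    using assms by (auto simp: site_cell_def nearest_sites_def dist_le_iff_inner)
  then show ?thesis
    by (simp only:) (intro convex_INT convex_halfspace_le)
qed

text \<open>With \<open>a\<close> the representative in \<open>T\<close> of the color of
  \<open>p\<close>, the affine function \<open>g\<close> below is nonnegative on the larger cell and
  vanishes exactly where \<open>p\<close> ties with \<open>a\<close>. A zero inside a segment with
  nonnegative ends forces zeros at both ends.\<close>

lemma site_cell_face_of:
  fixes A :: "'a::euclidean_space set"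
  assumes "T \<subseteq> S" "S \<subseteq> A" and rep: "\<And>p. p \<in> S \<Longrightarrow> \<exists>a\<in>T. f a = f p"
  shows "site_cell A f S face_of site_cell A f T"
  unfolding face_of_def
proof (intro conjI ballI impI)
  show "site_cell A f S \<subseteq> site_cell A f T"
    using assms by (auto simp: site_cell_def)
  show "convex (site_cell A f S)"
    using assms by (intro convex_site_cell)
  fix u w x
  assume u: "u \<in> site_cell A f T" and w: "w \<in> site_cell A f T"
    and x: "x \<in> site_cell A f S" and seg: "x \<in> open_segment u w"
  obtain t where t: "0 < t" "t < 1" "x = (1 - t) *\<^sub>R u + t *\<^sub>R w"
    using seg by (auto simp: in_segment)
  have "p \<in> nearest_sites A f u \<and> p \<in> nearest_sites A f w" if p: "p \<in> S" for p
  proof -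
    obtain a where a: "a \<in> T" "f a = f p" using rep[OF p] by blast
    have mem: "a \<in> nearest_sites A f u" "a \<in> nearest_sites A f w"
      "a \<in> nearest_sites A f x" "p \<in> nearest_sites A f x"
      using u w x a p assms by (auto simp: site_cell_def)
    define g where "g z = p \<bullet> p - a \<bullet> a - 2 * ((p - a) \<bullet> z)" for z
    have "g u \<ge> 0" "g w \<ge> 0"
      using mem a p assms(2) nearest_sites_le[of a A f u p] nearest_sites_le[of a A f w p]
      by (auto simp: g_def dist_le_iff_inner)
    moreover have "g x = 0"
      using nearest_sites_dist_eq[OF mem(3,4) a(2)] by (simp add: dist_eq_iff_inner g_def)
    moreover have "g x = (1 - t) * g u + t * g w"
      by (simp add: g_def t algebra_simps inner_add_right)
    ultimately have "(1 - t) * g u + t * g w = 0" "(1 - t) * g u \<ge> 0" "t * g w \<ge> 0"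
      using t by auto
    then have "g u = 0" "g w = 0"
      using t by (auto simp: add_nonneg_eq_0_iff)
    then have "dist u a = dist u p" "dist w a = dist w p"
      by (simp_all add: dist_eq_iff_inner g_def)
    then show ?thesis
      using mem a p assms(2) by (auto intro!: nearest_sitesI[of a A f])
  qed
  then show "u \<in> site_cell A f S" "w \<in> site_cell A f S"
    by (auto simp: site_cell_def)
qed

lemma finite_nearest_sites:
  fixes A :: "'a::metric_space set"
  assumes fin: "\<And>x \<rho>. finite (A \<inter> cball x \<rho>)" and "finite J" "f ` A \<subseteq> J"
  shows "finite (nearest_sites A f y)"
proof -
  have "finite {a \<in> nearest_sites A f y. f a = j}" for j
  proof (cases "\<exists>p. p \<in> nearest_sites A f y \<and> f p = j")
    case True
    then obtain p where "p \<in> nearest_sites A f y" "f p = j" by blast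
    then have "{a \<in> nearest_sites A f y. f a = j} \<subseteq> A \<inter> cball y (dist y p)"
      by (auto simp: nearest_sites_def)
    then show ?thesis using fin finite_subset by blast
  next
    case False
    then have "{a \<in> nearest_sites A f y. f a = j} = {}" by blast
    then show ?thesis by (simp only: finite.emptyI)
  qed
  moreover have "nearest_sites A f y \<subseteq> (\<Union>j\<in>J. {a \<in> nearest_sites A f y. f a = j})"
    using assms(3) nearest_sites_subset by fastforce
  ultimately show ?thesis
    using \<open>finite J\<close> by (meson finite_UN_I finite_subset)
qed

text \<open>The neighborhood must serve all competitors \<open>b\<close> at once. Only finitely many
  lie within \<open>dist y p + 1\<close> of \<open>y\<close>, and continuity handles those; the
  others stay farther by the triangle inequality.\<close>

lemma eventually_dist_less_other_sites:
  fixes A :: "'a::metric_space set"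
  assumes fin: "\<And>x \<rho>. finite (A \<inter> cball x \<rho>)" and p: "p \<in> nearest_sites A f y"
  shows "\<forall>\<^sub>F w in nhds y. \<forall>b\<in>A - nearest_sites A f y. f b = f p \<longrightarrow> dist w p < dist w b"
proof -
  define B where "B = {b \<in> A \<inter> cball y (dist y p + 1). b \<notin> nearest_sites A f y \<and> f b = f p}"
  have "finite B" unfolding B_def using fin by (auto intro: finite_subset[OF _ fin[of y "dist y p + 1"]])
  moreover have "\<forall>\<^sub>F w in nhds y. dist w p < dist w b" if b: "b \<in> B" for b
  proof -
    have "dist y p < dist y b"
      using nearest_sitesI[OF p, of b] b by (fastforce simp: B_def)
    moreover have "open {w. dist w p < dist w b}"
      by (intro open_Collect_less continuous_intros)
    ultimately show ?thesis by (auto simp: eventually_nhds)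
  qed
  ultimately have 1: "\<forall>\<^sub>F w in nhds y. \<forall>b\<in>B. dist w p < dist w b"
    by (simp add: eventually_ball_finite)
  \<comment> \<open>Moving less than 1/2 changes each of the two distances by less than 1/2, which
    the gap of 1 in the definition of \<open>B\<close> absorbs.\<close>
  have 2: "\<forall>\<^sub>F w in nhds y. dist w y < 1/2"
    by (auto simp: eventually_nhds_metric intro: exI[of _ "1/2"])
  show ?thesis using 1 2
  proof eventually_elim
    case (elim w)
    show ?case
    proof (intro ballI impI)
      fix b assume b: "b \<in> A - nearest_sites A f y" "f b = f p"
      show "dist w p < dist w b"
      proof (cases "b \<in> B")
        case False
        then have "dist y b > dist y p + 1" using b by (auto simp: B_def)
        moreover have "dist w p \<le> dist w y + dist y p" "dist y b \<le> dist w y + dist w b"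
          by (metis dist_triangle, metis dist_commute dist_triangle)
        ultimately show ?thesis using elim(2) by linarith
      qed (use elim in auto)
    qed
  qed
qed

text \<open>Constraints that are equalities at \<open>y\<close> are equalities on the whole cell, hence on the line
  through \<open>z\<close> and \<open>y\<close>; all others are strict at \<open>y\<close>.\<close>

lemma site_cell_extend_segment:
  fixes A :: "'a::euclidean_space set"
  assumes fin: "\<And>x \<rho>. finite (A \<inter> cball x \<rho>)" and finS: "finite (nearest_sites A f y)"
    and z: "z \<in> site_cell A f (nearest_sites A f y)" and "z \<noteq> y"
  shows "\<exists>w\<in>site_cell A f (nearest_sites A f y). y \<in> open_segment z w"
proof -
  let ?S = "nearest_sites A f y"
  have "\<forall>\<^sub>F w in nhds y. \<forall>p\<in>?S. \<forall>b\<in>A - ?S. f b = f p \<longrightarrow> dist w p < dist w b"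
    using eventually_dist_less_other_sites[OF fin] finS by (intro eventually_ball_finite) auto
  then obtain e where e: "e > 0"
    "\<And>w p b. \<lbrakk>dist w y < e; p \<in> ?S; b \<in> A - ?S; f b = f p\<rbrakk> \<Longrightarrow> dist w p < dist w b"
    by (auto simp: eventually_nhds_metric)
  define t where "t = e / (2 * norm (y - z))"
  define w where "w = y + t *\<^sub>R (y - z)"
  have t: "t > 0" using e assms by (simp add: t_def)
  have "dist w y = e / 2" using e \<open>z \<noteq> y\<close> by (simp add: w_def dist_norm t_def)
  then have wy: "dist w y < e" using e by simp
  have "?S \<subseteq> nearest_sites A f w"
  proof
    fix p assume p: "p \<in> ?S"
    have "dist w p \<le> dist w b" if b: "b \<in> A" "f b = f p" for b
    proof (cases "b \<in> ?S")
      case True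
      have "dist y p = dist y b" "dist z p = dist z b"
        using p True b z by (auto simp: site_cell_def intro!: nearest_sites_dist_eq[of _ A f])
      then have "2 * ((b - p) \<bullet> y) = b \<bullet> b - p \<bullet> p" "2 * ((b - p) \<bullet> z) = b \<bullet> b - p \<bullet> p"
        by (simp_all add: dist_eq_iff_inner)
      then have "2 * ((b - p) \<bullet> w) = b \<bullet> b - p \<bullet> p"
        by (simp add: w_def inner_add_right inner_diff_right)
      then show ?thesis by (simp add: dist_le_iff_inner)
    next
      case False
      then show ?thesis using e(2)[OF wy p] b by force
    qed
    then show "p \<in> nearest_sites A f w"
      using p by (auto simp: nearest_sites_def)
  qed
  moreover have "y \<in> open_segment z w"
  proof -
    have "w \<noteq> z"
    proof
      assume "w = z"
      then have "(1 + t) *\<^sub>R (y - z) = 0" by (simp add: w_def algebra_simps)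
      then show False using t \<open>z \<noteq> y\<close> by simp
    qed
    have "(1 + t) *\<^sub>R ((1 - 1 / (1 + t)) *\<^sub>R z + (1 / (1 + t)) *\<^sub>R w) = t *\<^sub>R z + w"
      using t by (simp add: scaleR_add_right field_simps)
    also have "\<dots> = (1 + t) *\<^sub>R y" by (simp add: w_def algebra_simps)
    finally have "y = (1 - 1 / (1 + t)) *\<^sub>R z + (1 / (1 + t)) *\<^sub>R w" using t by simp
    moreover have "0 < 1 / (1 + t)" "1 / (1 + t) < 1" using t by auto
    ultimately show ?thesis
      using \<open>w \<noteq> z\<close> unfolding in_segment by metis
  qed
  ultimately show ?thesis by (auto simp: site_cell_def)
qed

text \<open>The cell of the sites nearest at \<open>y\<close> is itself a face of the ambient cell
  and meets the relative interior of \<open>F\<close>, so it contains \<open>F\<close>. Conversely,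
  a segment from any of its points to \<open>y\<close> can be prolonged beyond \<open>y\<close>, and
  the face property of \<open>F\<close> pulls in the endpoint.\<close>

lemma face_eq_site_cell:
  fixes A :: "'a::euclidean_space set"
  assumes fin: "\<And>x \<rho>. finite (A \<inter> cball x \<rho>)" and "finite J" "f ` A \<subseteq> J"
    and T: "T \<subseteq> A" "J \<subseteq> f ` T"
    and F: "F face_of site_cell A f T" and y: "y \<in> rel_interior F"
  shows "F = site_cell A f (nearest_sites A f y)"
proof
  let ?S = "nearest_sites A f y"
  have yF: "y \<in> F" using y rel_interior_subset by auto
  then have "y \<in> site_cell A f T" using F face_of_imp_subset by auto
  then have TS: "T \<subseteq> ?S" by (auto simp: site_cell_def)
  have face: "site_cell A f ?S face_of site_cell A f T"
  proof (rule site_cell_face_of[OF TS nearest_sites_subset])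
    fix p assume "p \<in> ?S"
    then have "f p \<in> f ` T" using assms(3) T nearest_sites_subset by fastforce
    then show "\<exists>a\<in>T. f a = f p" by (metis imageE)
  qed
  show "F \<subseteq> site_cell A f ?S"
    using face y F face_of_imp_subset
    by (intro subset_of_face_of[OF face]) (auto simp: disjnt_def site_cell_def)
  show "site_cell A f ?S \<subseteq> F"
  proof
    fix z assume z: "z \<in> site_cell A f ?S"
    show "z \<in> F"
    proof (cases "z = y")
      case False
      obtain w where w: "w \<in> site_cell A f ?S" "y \<in> open_segment z w"
        using site_cell_extend_segment[OF fin finite_nearest_sites[OF fin assms(2,3)] z False] by blast
      then show ?thesis
        using face_ofD[OF F w(2) _ _ yF] z w face face_of_imp_subset by blast
    qed (use yF in simp)
  qed
qed

text \<open>\<open>y\<close> lies on every bisector between \<open>p\<close> and the representative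
  \<open>a (f p)\<close>, whose normal is \<open>p - a (f p)\<close>. Ties at \<open>z\<close> for a
  basis of the span of these normals make \<open>z - y\<close> orthogonal to all of them, which
  yields the remaining ties.\<close>

lemma site_cell_eq_small:
  fixes A :: "'a::euclidean_space set"
  assumes fin: "finite (nearest_sites A f y)" and "finite J" and J: "f ` A \<subseteq> J"
    and T: "T \<subseteq> nearest_sites A f y" "J \<subseteq> f ` T"
  shows "\<exists>U\<subseteq>nearest_sites A f y. card U \<le> DIM('a) + card J \<and>
           site_cell A f U = site_cell A f (nearest_sites A f y)"
proof -
  let ?S = "nearest_sites A f y"
  obtain a where a: "\<And>j. j \<in> J \<Longrightarrow> a j \<in> T \<and> f (a j) = j"
    using T(2) by (metis image_iff subsetD)
  have fJ: "f p \<in> J" if "p \<in> ?S" for p using that J nearest_sites_subset by fastforce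
  define V where "V = (\<lambda>p. p - a (f p)) ` ?S"
  obtain B where B: "B \<subseteq> V" "independent B" "V \<subseteq> span B" "card B = dim V"
    using basis_exists by blast
  obtain U0 where U0: "U0 \<subseteq> ?S" "B = (\<lambda>p. p - a (f p)) ` U0" "inj_on (\<lambda>p. p - a (f p)) U0"
    using B(1) unfolding V_def subset_image_inj by blast
  have "card U0 = dim V" using U0 B by (simp add: card_image)
  then have cU0: "card U0 \<le> DIM('a)" by (simp add: dim_subset_UNIV)
  \<comment> \<open>The representatives are kept as well, both as reference sites for the ties and
    to carry the inequalities against all other sites.\<close>
  define U where "U = U0 \<union> a ` J"
  have US: "U \<subseteq> ?S" using U0 a T by (auto simp: U_def)
  have "card U \<le> card U0 + card (a ` J)" unfolding U_def by (rule card_Un_le)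
  also have "\<dots> \<le> DIM('a) + card J" using cU0 card_image_le[OF \<open>finite J\<close>, of a] by linarith
  finally have "card U \<le> DIM('a) + card J" .
  moreover have "site_cell A f U = site_cell A f ?S"
  proof
    show "site_cell A f ?S \<subseteq> site_cell A f U" using US by (auto simp: site_cell_def)
    show "site_cell A f U \<subseteq> site_cell A f ?S"
    proof
      fix z assume "z \<in> site_cell A f U"
      then have z: "U \<subseteq> nearest_sites A f z" by (simp add: site_cell_def)
      have eqy: "dist y (a (f p)) = dist y p" if "p \<in> ?S" for p
        using that fJ[OF that] a T by (intro nearest_sites_dist_eq[of _ A f]) auto
      have "(z - y) \<bullet> v = 0" if v: "v \<in> B" for v
      proof -
        obtain p where p: "p \<in> U0" "v = p - a (f p)" using U0(2) v by auto
        have "f p \<in> J" using p U0 fJ by blast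
        then have "dist z (a (f p)) = dist z p"
          using p a z by (intro nearest_sites_dist_eq[of _ A f]) (auto simp: U_def)
        then show ?thesis
          using eqy[of p] p U0
          by (auto simp: dist_eq_iff_inner inner_diff_left inner_diff_right inner_commute)
      qed
      then have "B \<subseteq> {v. (z - y) \<bullet> v = 0}" by auto
      then have "span B \<subseteq> {v. (z - y) \<bullet> v = 0}"
        by (intro span_minimal subspace_hyperplane)
      then have perp: "(z - y) \<bullet> v = 0" if "v \<in> V" for v using B that by blast
      have "p \<in> nearest_sites A f z" if p: "p \<in> ?S" for p
      proof -
        have "(z - y) \<bullet> (p - a (f p)) = 0" using p by (intro perp) (auto simp: V_def)
        then have "dist z (a (f p)) = dist z p"
          using eqy[OF p]
          by (auto simp: dist_eq_iff_inner inner_diff_left inner_diff_right inner_commute)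
        then show ?thesis
          using a fJ[OF p] z p nearest_sites_subset[of A f y]
          by (intro nearest_sitesI[of "a (f p)" A f z p]) (auto simp: U_def)
      qed
      then show "z \<in> site_cell A f ?S" by (auto simp: site_cell_def)
    qed
  qed
  ultimately show ?thesis using US by blast
qed


section \<open>Indexing and counting the cells of the overlay\<close>

text \<open>Picking a Voronoi domain in each color amounts to picking a site in each color. A color
  of \<open>J\<close> that no site has leaves no choice, hence no top cell.\<close>

lemma overlay_top_cells_Vor_iff:
  fixes A :: "'a::euclidean_space set"
  shows "c \<in> overlay_top_cells J (\<lambda>j. Vor (color_class A f j)) \<longleftrightarrow>
    (\<exists>a. (\<forall>j\<in>J. a j \<in> A \<and> f (a j) = j) \<and> c = site_cell A f (a ` J) \<and> interior c \<noteq> {})"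
proof -
  have cell: "(\<Inter>j\<in>J. voronoi_domain (color_class A f j) (a j)) = site_cell A f (a ` J)"
    if "\<forall>j\<in>J. a j \<in> A \<and> f (a j) = j" for a
    using that by (fastforce simp: voronoi_domain_def color_class_def site_cell_def nearest_sites_def)
  show ?thesis
  proof
    assume "c \<in> overlay_top_cells J (\<lambda>j. Vor (color_class A f j))"
    then obtain \<nu> where \<nu>: "\<forall>j\<in>J. \<nu> j \<in> Vor (color_class A f j)" "c = (\<Inter>j\<in>J. \<nu> j)"
      and int: "interior c \<noteq> {}"
      unfolding overlay_top_cells_def by blast
    then obtain a where a: "\<forall>j\<in>J. a j \<in> color_class A f j \<and> \<nu> j = voronoi_domain (color_class A f j) (a j)"
      unfolding Vor_def image_iff by metis
    then have a': "\<forall>j\<in>J. a j \<in> A \<and> f (a j) = j" by (auto simp: color_class_def)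
    have "c = (\<Inter>j\<in>J. voronoi_domain (color_class A f j) (a j))" using \<nu>(2) a by simp
    with cell[OF a'] a' int show "\<exists>a. (\<forall>j\<in>J. a j \<in> A \<and> f (a j) = j) \<and>
        c = site_cell A f (a ` J) \<and> interior c \<noteq> {}"
      by auto
  next
    assume "\<exists>a. (\<forall>j\<in>J. a j \<in> A \<and> f (a j) = j) \<and> c = site_cell A f (a ` J) \<and> interior c \<noteq> {}"
    then obtain a where a: "\<forall>j\<in>J. a j \<in> A \<and> f (a j) = j" "c = site_cell A f (a ` J)" "interior c \<noteq> {}"
      by blast
    then have "c = (\<Inter>j\<in>J. voronoi_domain (color_class A f j) (a j))" using cell by simp
    moreover have "\<forall>j\<in>J. voronoi_domain (color_class A f j) (a j) \<in> Vor (color_class A f j)"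
      using a by (auto simp: Vor_def color_class_def)
    ultimately show "c \<in> overlay_top_cells J (\<lambda>j. Vor (color_class A f j))"
      using a(3) unfolding overlay_top_cells_def
      by (intro CollectI exI[of _ "\<lambda>j. voronoi_domain (color_class A f j) (a j)"]) auto
  qed
qed

text \<open>A cell \<open>F\<close> is encoded by the set \<open>S\<close> of sites that are nearest at the relative interior
  points of \<open>F\<close>. Requiring such a point within distance 1 of the vertex makes the condition
  depend only on the sites in a bounded region.\<close>

definition indexes_cell_with_vertex_in ::
    "'a::euclidean_space set \<Rightarrow> 'j set \<Rightarrow> ('a \<Rightarrow> 'j) \<Rightarrow> 'a set \<Rightarrow> 'a set \<Rightarrow> bool" where
  "indexes_cell_with_vertex_in A J f \<Omega> S \<longleftrightarrow>
     (\<exists>v\<in>\<Omega>. \<exists>y a. dist v y < 1 \<and> nearest_sites A f y = S \<and> (\<forall>j\<in>J. a j \<in> S \<and> f (a j) = j) \<and>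
        interior (site_cell A f (a ` J)) \<noteq> {} \<and> v extreme_point_of site_cell A f S)"

lemma Ovl_cells_with_vertex_in_eq:
  fixes A :: "'a::euclidean_space set"
  assumes fin: "\<And>x \<rho>. finite (A \<inter> cball x \<rho>)" and J: "finite J" "f ` A \<subseteq> J"
  shows "{F \<in> Ovl J (\<lambda>j. Vor (color_class A f j)). \<exists>v\<in>\<Omega>. v extreme_point_of F} =
    site_cell A f ` {S. indexes_cell_with_vertex_in A J f \<Omega> S}" (is "?L = ?R")
proof (intro equalityI subsetI)
  fix F assume "F \<in> ?L"
  then obtain c v where "F \<noteq> {}" and c: "c \<in> overlay_top_cells J (\<lambda>j. Vor (color_class A f j))"
    and F: "F face_of c" and v: "v \<in> \<Omega>" "v extreme_point_of F"
    by (auto simp: Ovl_def)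
  obtain a where a: "\<forall>j\<in>J. a j \<in> A \<and> f (a j) = j" "c = site_cell A f (a ` J)" "interior c \<noteq> {}"
    using c unfolding overlay_top_cells_Vor_iff by blast
  have "convex F" using F face_of_imp_convex by blast
  \<comment> \<open>A convex set lies in the closure of its relative interior, so a suitable
    \<open>y\<close> exists arbitrarily close to the vertex; the distance 1 is an arbitrary
    choice.\<close>
  then have "v \<in> closure (rel_interior F)"
    using v convex_closure_rel_interior closure_subset by (fastforce simp: extreme_point_of_def)
  then obtain y where y: "y \<in> rel_interior F" "dist y v < 1"
    by (meson closure_approachable zero_less_one)
  have aJ: "a ` J \<subseteq> A" "J \<subseteq> f ` a ` J" using a by (auto simp: image_iff)
  have Feq: "F = site_cell A f (nearest_sites A f y)"
    using F a(2) by (intro face_eq_site_cell[OF fin J aJ _ y(1)]) simp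
  have "y \<in> c" using y F face_of_imp_subset rel_interior_subset by blast
  then have "\<forall>j\<in>J. a j \<in> nearest_sites A f y" using a by (auto simp: site_cell_def)
  then have "indexes_cell_with_vertex_in A J f \<Omega> (nearest_sites A f y)"
    unfolding indexes_cell_with_vertex_in_def using v a y Feq
    by (intro bexI[of _ v] exI[of _ y] exI[of _ a]) (auto simp: dist_commute)
  then show "F \<in> ?R" using Feq by blast
next
  fix F assume "F \<in> ?R"
  then obtain v y a where v: "v \<in> \<Omega>" "v extreme_point_of F"
    and F: "F = site_cell A f (nearest_sites A f y)"
    and a: "\<forall>j\<in>J. a j \<in> nearest_sites A f y \<and> f (a j) = j" "interior (site_cell A f (a ` J)) \<noteq> {}"
    unfolding indexes_cell_with_vertex_in_def by blast
  have "F face_of site_cell A f (a ` J)"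
    unfolding F
  proof (rule site_cell_face_of)
    fix p assume "p \<in> nearest_sites A f y"
    then have "f p \<in> J" using J nearest_sites_subset by fastforce
    then show "\<exists>b\<in>a ` J. f b = f p" using a by blast
  qed (use a nearest_sites_subset[of A f y] in auto)
  moreover have "site_cell A f (a ` J) \<in> overlay_top_cells J (\<lambda>j. Vor (color_class A f j))"
    unfolding overlay_top_cells_Vor_iff using a nearest_sites_subset[of A f y]
    by (intro exI[of _ a]) auto
  moreover have "F \<noteq> {}" using v by (auto simp: extreme_point_of_def)
  ultimately show "F \<in> ?L" using v by (auto simp: Ovl_def)
qed

text \<open>The point \<open>y\<close> behind \<open>S\<close> lies in the cell of \<open>S\<close>,
  hence in that of \<open>S'\<close>, which gives \<open>S' \<subseteq> S\<close>; the other
  inclusion is symmetric. Counting cells thereby becomes counting index sets.\<close>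

lemma inj_on_site_cell:
  "inj_on (site_cell A f) {S. indexes_cell_with_vertex_in A J f \<Omega> S}"
proof (rule inj_onI)
  fix S S'
  assume "S \<in> {S. indexes_cell_with_vertex_in A J f \<Omega> S}" "S' \<in> {S. indexes_cell_with_vertex_in A J f \<Omega> S}"
    and eq: "site_cell A f S = site_cell A f S'"
  then obtain y y' where "nearest_sites A f y = S" "nearest_sites A f y' = S'"
    unfolding indexes_cell_with_vertex_in_def by blast
  moreover from this have "y \<in> site_cell A f S'" "y' \<in> site_cell A f S"
    using eq by (auto simp: site_cell_def)
  ultimately show "S = S'" by (auto simp: site_cell_def)
qed

lemma emeasure_count_space_image:
  assumes "inj_on g X"
  shows "emeasure (count_space UNIV) (g ` X) = emeasure (count_space UNIV) X"
  using assms by (cases "finite X") (auto simp: card_image finite_image_iff)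

lemma num_cells_with_vertex_in_eq:
  fixes A :: "'a::euclidean_space set"
  assumes "\<And>x \<rho>. finite (A \<inter> cball x \<rho>)" "finite J" "f ` A \<subseteq> J"
  shows "num_cells_with_vertex_in \<Omega> (Ovl J (\<lambda>j. Vor (color_class A f j))) =
    emeasure (count_space UNIV) {S. indexes_cell_with_vertex_in A J f \<Omega> S}"
  unfolding num_cells_with_vertex_in_def Ovl_cells_with_vertex_in_eq[OF assms]
  by (rule emeasure_count_space_image[OF inj_on_site_cell])

section \<open>Bounding the number of cells near a point\<close>

text \<open>A site of the right color within \<open>\<tau>\<close> of \<open>x\<close> is within
  \<open>\<tau> + \<rho>\<close> of \<open>z\<close>, which bounds \<open>dist z p\<close>;
  returning from \<open>z\<close> to \<open>x\<close> costs another \<open>\<rho>\<close>.\<close>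

lemma nearest_sites_subset_cball:
  fixes A :: "'a::metric_space set"
  assumes "f ` A \<subseteq> J" and col: "\<And>j. j \<in> J \<Longrightarrow> \<exists>b\<in>A. f b = j \<and> dist x b \<le> \<tau>"
    and "dist x z \<le> \<rho>"
  shows "nearest_sites A f z \<subseteq> A \<inter> cball x (\<tau> + 2 * \<rho>)"
proof
  fix p assume p: "p \<in> nearest_sites A f z"
  then have "p \<in> A" using nearest_sites_subset by blast
  then obtain b where b: "b \<in> A" "f b = f p" "dist x b \<le> \<tau>" using assms(1) col by blast
  have "dist z p \<le> dist z b" using nearest_sites_le[OF p] b by blast
  moreover have "dist x p \<le> dist x z + dist z p" "dist z b \<le> dist x z + dist x b"
    by (metis dist_triangle) (metis dist_triangle3 dist_commute)
  ultimately show "p \<in> A \<inter> cball x (\<tau> + 2 * \<rho>)" using \<open>p \<in> A\<close> b assms(3) by simp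
qed

text \<open>Each such set is the set of entries of a list of length at most \<open>k\<close>. The
  bound is crude but polynomial in \<open>card Q\<close>; the summand 1 in the base keeps it at
  least 1, so powers grow with the exponent even for empty \<open>Q\<close>.\<close>

lemma card_small_subsets_le:
  assumes "finite Q"
  shows "finite {T. T \<subseteq> Q \<and> card T \<le> k}"
    and "card {T. T \<subseteq> Q \<and> card T \<le> k} \<le> (k + 1) * (card Q + 1) ^ k"
proof -
  let ?X = "{xs. set xs \<subseteq> Q \<and> length xs \<le> k}"
  show "finite {T. T \<subseteq> Q \<and> card T \<le> k}" using assms by auto
  have finX: "finite ?X" using finite_lists_length_le[OF assms] .
  have "{T. T \<subseteq> Q \<and> card T \<le> k} \<subseteq> set ` ?X"
  proof
    fix T assume T: "T \<in> {T. T \<subseteq> Q \<and> card T \<le> k}"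
    then obtain xs where "set xs = T" "distinct xs"
      using finite_distinct_list finite_subset assms by (metis mem_Collect_eq)
    then show "T \<in> set ` ?X" using T by (intro image_eqI[of _ _ xs]) (auto simp: distinct_card)
  qed
  then have "card {T. T \<subseteq> Q \<and> card T \<le> k} \<le> card ?X"
    using finX by (meson card_image_le card_mono finite_imageI le_trans)
  also have "\<dots> = (\<Sum>i\<le>k. card Q ^ i)" by (rule card_lists_length_le[OF assms])
  also have "\<dots> \<le> (\<Sum>i\<le>k. (card Q + 1) ^ k)"
  proof (rule sum_mono)
    fix i assume "i \<in> {..k}"
    have "card Q ^ i \<le> (card Q + 1) ^ i" by (rule power_mono) auto
    also have "\<dots> \<le> (card Q + 1) ^ k" using \<open>i \<in> {..k}\<close> by (intro power_increasing) auto
    finally show "card Q ^ i \<le> (card Q + 1) ^ k" .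
  qed
  finally show "card {T. T \<subseteq> Q \<and> card T \<le> k} \<le> (k + 1) * (card Q + 1) ^ k" by simp
qed

lemma num_cells_with_vertex_in_cball_le:
  fixes A :: "'a::euclidean_space set"
  assumes fin: "\<And>x \<rho>. finite (A \<inter> cball x \<rho>)" and J: "finite J" "f ` A \<subseteq> J"
    and col: "\<And>j. j \<in> J \<Longrightarrow> \<exists>b\<in>A. f b = j \<and> dist x b \<le> \<tau>"
  defines "k \<equiv> DIM('a) + card J"
  shows "num_cells_with_vertex_in (cball x \<rho>) (Ovl J (\<lambda>j. Vor (color_class A f j)))
    \<le> of_nat ((k + 1) * (card (A \<inter> cball x (\<tau> + 2 * \<rho>)) + 1) ^ k)"
proof -
  let ?Q = "A \<inter> cball x (\<tau> + 2 * \<rho>)" and ?I = "{S. indexes_cell_with_vertex_in A J f (cball x \<rho>) S}"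
  let ?X = "{T. T \<subseteq> ?Q \<and> card T \<le> k}"
  \<comment> \<open>Cells are compared rather than index sets: the thinned sets need not be index
    sets, and several may give the same cell.\<close>
  have "site_cell A f ` ?I \<subseteq> site_cell A f ` ?X"
  proof
    fix F assume "F \<in> site_cell A f ` ?I"
    then obtain v y a where v: "v \<in> cball x \<rho>" "v extreme_point_of F"
      and F: "F = site_cell A f (nearest_sites A f y)"
      and a: "\<forall>j\<in>J. a j \<in> nearest_sites A f y \<and> f (a j) = j"
      unfolding indexes_cell_with_vertex_in_def by blast
    have aJ: "a ` J \<subseteq> nearest_sites A f y" "J \<subseteq> f ` a ` J" using a by (auto simp: image_iff)
    obtain U where U: "U \<subseteq> nearest_sites A f y" "card U \<le> k"
      "site_cell A f U = site_cell A f (nearest_sites A f y)"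
      using site_cell_eq_small[OF finite_nearest_sites[OF fin J] J aJ] unfolding k_def by blast
    \<comment> \<open>The vertex \<open>v\<close> belongs to the cell, so the sites of the cell are
      nearest at \<open>v\<close> as well, and \<open>v\<close> is known to lie in the ball.\<close>
    have "nearest_sites A f y \<subseteq> nearest_sites A f v"
      using v F by (auto simp: extreme_point_of_def site_cell_def)
    also have "\<dots> \<subseteq> ?Q"
      using v by (intro nearest_sites_subset_cball[OF J(2) col]) auto
    finally show "F \<in> site_cell A f ` ?X" using U F by blast
  qed
  then have "num_cells_with_vertex_in (cball x \<rho>) (Ovl J (\<lambda>j. Vor (color_class A f j)))
      \<le> emeasure (count_space UNIV) (site_cell A f ` ?X)"
    unfolding num_cells_with_vertex_in_def Ovl_cells_with_vertex_in_eq[OF fin J]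
    by (intro emeasure_mono) auto
  also have "\<dots> = of_nat (card (site_cell A f ` ?X))"
    using card_small_subsets_le(1)[OF fin] by (intro emeasure_count_space_finite) auto
  also have "\<dots> \<le> of_nat ((k + 1) * (card ?Q + 1) ^ k)"
    using card_small_subsets_le[OF fin, of x "\<tau> + 2 * \<rho>" k]
    by (intro of_nat_mono) (meson card_image_le le_trans)
  finally show ?thesis .
qed

section \<open>Dependence of cells on finitely many colors\<close>

text \<open>Since \<open>p\<close> is at most as far from \<open>z\<close> as some site
  \<open>q\<close> seen within \<open>\<tau>\<close> of \<open>x\<close>, it is closer to
  \<open>z\<close> than every site outside the larger ball, whatever color \<open>g\<close> gives to
  that site.\<close>

lemma nearest_sites_local_subset:
  fixes A :: "'a::metric_space set"
  assumes J: "f ` A \<subseteq> J"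
    and col: "\<And>j. j \<in> J \<Longrightarrow> \<exists>b\<in>A. f b = j \<and> dist x b \<le> \<tau>"
    and eq: "\<And>b. b \<in> A \<inter> cball x (\<tau> + 2 * \<rho>) \<Longrightarrow> f b = g b"
    and z: "dist x z \<le> \<rho>"
  shows "nearest_sites A f z \<subseteq> nearest_sites A g z"
proof
  fix p assume p: "p \<in> nearest_sites A f z"
  then have pQ: "p \<in> A \<inter> cball x (\<tau> + 2 * \<rho>)"
    using nearest_sites_subset_cball[OF J col z] by blast
  then obtain q where q: "q \<in> A" "f q = f p" "dist x q \<le> \<tau>" using J col by blast
  have "dist z p \<le> dist z b" if b: "b \<in> A" "g b = g p" for b
  proof (cases "b \<in> cball x (\<tau> + 2 * \<rho>)")
    case True
    then have "f b = f p" using eq[of b] eq[OF pQ] b by simp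
    then show ?thesis using nearest_sites_le[OF p] b by blast
  next
    case False
    have "dist z p \<le> dist z q" using nearest_sites_le[OF p] q by blast
    moreover have "dist z q \<le> dist x z + dist x q" "dist x b \<le> dist x z + dist z b"
      by (metis dist_triangle3 dist_commute) (metis dist_triangle)
    ultimately show ?thesis using False z q by simp
  qed
  then show "p \<in> nearest_sites A g z" using pQ by (auto simp: nearest_sites_def)
qed

text \<open>A segment of \<open>G\<close> through \<open>v\<close> can be shrunk towards
  \<open>v\<close> until its ends lie in \<open>U\<close>, where \<open>F\<close> and
  \<open>G\<close> coincide. Convexity of \<open>G\<close> keeps the shrunk ends in
  \<open>G\<close>.\<close>

lemma extreme_point_of_local:
  fixes F G :: "'a::euclidean_space set"
  assumes "convex G" "open U" "v \<in> U" "F \<inter> U = G \<inter> U" "v extreme_point_of F"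
  shows "v extreme_point_of G"
  unfolding extreme_point_of_def
proof (intro conjI ballI notI)
  show vG: "v \<in> G" using assms by (auto simp: extreme_point_of_def)
  fix p q assume pq: "p \<in> G" "q \<in> G" "v \<in> open_segment p q"
  obtain e where e: "e > 0" "ball v e \<subseteq> U" using assms(2,3) open_contains_ball by blast
  obtain t where t: "0 < t" "t < 1" "v = (1 - t) *\<^sub>R p + t *\<^sub>R q" and "p \<noteq> q"
    using pq(3) by (auto simp: in_segment)
  define \<delta> where "\<delta> = min 1 (e / (2 * norm (q - p)))"
  have \<delta>: "0 < \<delta>" "\<delta> \<le> 1" using e \<open>p \<noteq> q\<close> by (auto simp: \<delta>_def)
  define p' q' where "p' = (1 - \<delta>) *\<^sub>R v + \<delta> *\<^sub>R p" and "q' = (1 - \<delta>) *\<^sub>R v + \<delta> *\<^sub>R q"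
  have mem: "p' \<in> G" "q' \<in> G"
    using \<open>convex G\<close> vG pq \<delta> by (auto simp: p'_def q'_def intro!: convexD)
  have "\<delta> * norm (q - p) \<le> (e / (2 * norm (q - p))) * norm (q - p)"
    by (intro mult_right_mono) (auto simp: \<delta>_def)
  also have "\<dots> = e / 2" using \<open>p \<noteq> q\<close> by simp
  finally have small: "\<delta> * norm (q - p) < e" using e by simp
  have dp: "p' - v = (- (\<delta> * t)) *\<^sub>R (q - p)" and dq: "q' - v = (\<delta> * (1 - t)) *\<^sub>R (q - p)"
    by (simp_all add: p'_def q'_def t(3) algebra_simps)
  have "norm (p' - v) = t * (\<delta> * norm (q - p))" "norm (q' - v) = (1 - t) * (\<delta> * norm (q - p))"
    unfolding dp dq using t \<delta> by simp_all
  moreover have "t * (\<delta> * norm (q - p)) \<le> \<delta> * norm (q - p)" "(1 - t) * (\<delta> * norm (q - p)) \<le> \<delta> * norm (q - p)"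
    using t \<delta> by (auto intro!: mult_left_le_one_le)
  ultimately have "dist v p' < e" "dist v q' < e"
    using small by (simp_all add: dist_norm norm_minus_commute)
  then have "p' \<in> F" "q' \<in> F" using mem e(2) assms(4) by auto
  moreover have "v \<in> open_segment p' q'"
  proof -
    have "(1 - t) *\<^sub>R p' + t *\<^sub>R q' = (1 - \<delta>) *\<^sub>R v + \<delta> *\<^sub>R ((1 - t) *\<^sub>R p + t *\<^sub>R q)"
      by (simp add: p'_def q'_def algebra_simps)
    also have "\<dots> = v" unfolding t(3)[symmetric] by (simp add: algebra_simps)
    finally have "v = (1 - t) *\<^sub>R p' + t *\<^sub>R q'" by simp
    moreover have "p' \<noteq> q'" using \<delta> \<open>p \<noteq> q\<close> by (simp add: p'_def q'_def)
    ultimately show ?thesis using t unfolding in_segment by blast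
  qed
  ultimately show False using assms(5) by (auto simp: extreme_point_of_def)
qed

text \<open>\<open>v\<close> and \<open>y\<close> both lie in the open ball of radius
  \<open>\<omega> + 1\<close>, where the two colorings have the same nearest sites and hence the
  same cells; the conditions on the cells are checked inside that ball.\<close>

lemma indexes_cell_with_vertex_in_local:
  fixes A :: "'a::euclidean_space set"
  assumes J: "f ` A \<subseteq> J" "g ` A \<subseteq> J"
    and \<omega>: "0 \<le> \<omega>"
    and col: "\<And>j. j \<in> J \<Longrightarrow> \<exists>b\<in>A. f b = j \<and> dist x b \<le> \<tau>"
    and eq: "\<And>b. b \<in> A \<inter> cball x (\<tau> + 2 * (\<omega> + 1)) \<Longrightarrow> f b = g b"
    and f: "indexes_cell_with_vertex_in A J f (cball x \<omega>) S"
  shows "indexes_cell_with_vertex_in A J g (cball x \<omega>) S"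
proof -
  let ?U = "ball x (\<omega> + 1)"
  have col': "\<exists>b\<in>A. g b = j \<and> dist x b \<le> \<tau>" if j: "j \<in> J" for j
  proof -
    obtain b where b: "b \<in> A" "f b = j" "dist x b \<le> \<tau>" using col j by blast
    moreover have "f b = g b" using b \<omega> by (intro eq) auto
    ultimately show ?thesis by auto
  qed
  have M: "nearest_sites A f z = nearest_sites A g z" if "z \<in> ?U" for z
  proof
    show "nearest_sites A f z \<subseteq> nearest_sites A g z"
      using that by (intro nearest_sites_local_subset[OF J(1) col eq]) auto
    show "nearest_sites A g z \<subseteq> nearest_sites A f z"
      using that by (intro nearest_sites_local_subset[OF J(2) col' eq[symmetric]]) auto
  qed
  have cell: "site_cell A f T \<inter> ?U = site_cell A g T \<inter> ?U" for T
    using M by (auto simp: site_cell_def)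
  obtain v y a where v: "v \<in> cball x \<omega>" "v extreme_point_of site_cell A f S"
    and y: "dist v y < 1" "nearest_sites A f y = S"
    and a: "\<forall>j\<in>J. a j \<in> S \<and> f (a j) = j" "interior (site_cell A f (a ` J)) \<noteq> {}"
    using f unfolding indexes_cell_with_vertex_in_def by blast
  have "dist x y \<le> dist x v + dist v y" by (rule dist_triangle)
  then have yU: "y \<in> ?U" and vU: "v \<in> ?U" using v y by auto
  have S: "nearest_sites A g y = S" using M[OF yU] y by simp
  have SA: "S \<subseteq> A" using S nearest_sites_subset by blast
  have SQ: "S \<subseteq> A \<inter> cball x (\<tau> + 2 * (\<omega> + 1))"
    unfolding y(2)[symmetric] using yU by (intro nearest_sites_subset_cball[OF J(1) col]) auto
  have "\<forall>j\<in>J. a j \<in> S \<and> g (a j) = j" using a(1) eq SQ by (metis subsetD)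
  moreover have "interior (site_cell A g (a ` J)) \<noteq> {}"
  proof -
    let ?c = "site_cell A f (a ` J)"
    have "convex ?c" using a SA by (intro convex_site_cell) auto
    \<comment> \<open>The interior of the top cell may reach far away. Being convex with nonempty
      interior, the cell has interior points arbitrarily close to \<open>v\<close>, hence inside the
      ball.\<close>
    then have "closure (interior ?c) = closure ?c" using convex_closure_interior a(2) by blast
    moreover have "v \<in> ?c" using v a(1) by (auto simp: extreme_point_of_def site_cell_def)
    ultimately have "v \<in> closure (interior ?c)" using closure_subset by blast
    then have "interior ?c \<inter> ?U \<noteq> {}"
      using vU by (meson closure_iff_nhds_not_empty disjoint_iff open_ball order_refl)
    moreover have "interior ?c \<inter> ?U \<subseteq> interior (site_cell A g (a ` J))"
      using cell[of "a ` J"] interior_subset[of ?c] by (intro interior_maximal) auto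
    ultimately show ?thesis by blast
  qed
  moreover have "v extreme_point_of site_cell A g S"
    using extreme_point_of_local[OF convex_site_cell[OF SA] open_ball vU cell v(2)] .
  ultimately show ?thesis
    unfolding indexes_cell_with_vertex_in_def using v(1) y(1) S by blast
qed


section \<open>Delone sets and random colorings\<close>

lemma delone_dist_ge:
  fixes A :: "'a::euclidean_space set"
  assumes "delone r R A" "p \<in> A" "q \<in> A" "p \<noteq> q"
  shows "2 * r \<le> dist p q"
proof (rule ccontr)
  assume "\<not> 2 * r \<le> dist p q"
  then have "p \<in> A \<inter> ball (midpoint p q) r" "q \<in> A \<inter> ball (midpoint p q) r"
    using assms by (auto simp: dist_midpoint)
  then show False using assms unfolding delone_def by blast
qed

text \<open>Volume packing: the balls of radius \<open>r\<close> about the sites are disjoint and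
  contained in the ball of radius \<open>\<rho> + r\<close>.\<close>

lemma delone_card_cball_le:
  fixes A :: "'a::euclidean_space set"
  assumes del: "delone r R A" and r: "0 < r" and \<rho>: "0 \<le> \<rho>"
  shows "finite (A \<inter> cball x \<rho>)" and "real (card (A \<inter> cball x \<rho>)) \<le> ((\<rho> + r) / r) ^ DIM('a)"
proof -
  \<comment> \<open>The bound is proved for finite subsets first, because finiteness of the whole
    intersection is derived from it.\<close>
  have bound: "real (card G) \<le> ((\<rho> + r) / r) ^ DIM('a)" if G: "G \<subseteq> A \<inter> cball x \<rho>" "finite G" for G
  proof -
    let ?u = "unit_ball_vol (real DIM('a))"
    have disj: "disjoint_family_on (\<lambda>p. ball p r) G"
      unfolding disjoint_family_on_def
    proof (intro ballI impI)
      fix p q assume pq: "p \<in> G" "q \<in> G" "p \<noteq> q"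
      then have "2 * r \<le> dist p q" using G by (intro delone_dist_ge[OF del]) auto
      then show "ball p r \<inter> ball q r = {}" by (intro disjoint_ballI) simp
    qed
    have "of_nat (card G) * ennreal (?u * r ^ DIM('a)) = (\<Sum>p\<in>G. emeasure lborel (ball p r))"
      using r by (simp add: emeasure_ball)
    also have "\<dots> = emeasure lborel (\<Union>p\<in>G. ball p r)"
      using G disj by (intro sum_emeasure) auto
    also have "\<dots> \<le> emeasure lborel (cball x (\<rho> + r))"
    proof (rule emeasure_mono)
      show "(\<Union>p\<in>G. ball p r) \<subseteq> cball x (\<rho> + r)"
      proof
        fix z assume "z \<in> (\<Union>p\<in>G. ball p r)"
        then obtain p where p: "p \<in> G" "dist p z < r" by auto
        then have "dist x p \<le> \<rho>" using G by auto
        then show "z \<in> cball x (\<rho> + r)" using p dist_triangle[of x z p] by simp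
      qed
    qed simp
    also have "\<dots> = ennreal (?u * (\<rho> + r) ^ DIM('a))"
      using r \<rho> by (simp add: emeasure_cball)
    finally have "ennreal (real (card G) * (?u * r ^ DIM('a))) \<le> ennreal (?u * (\<rho> + r) ^ DIM('a))"
      using r by (simp add: ennreal_mult' ennreal_of_nat_eq_real_of_nat)
    then have "real (card G) * (?u * r ^ DIM('a)) \<le> ?u * (\<rho> + r) ^ DIM('a)"
      using r \<rho> by (subst (asm) ennreal_le_iff) auto
    then have "?u * (real (card G) * r ^ DIM('a)) \<le> ?u * (\<rho> + r) ^ DIM('a)"
      by (simp add: mult_ac)
    then have "real (card G) * r ^ DIM('a) \<le> (\<rho> + r) ^ DIM('a)"
      by (subst (asm) mult_le_cancel_left_pos) auto
    then show ?thesis using r by (simp add: power_divide pos_le_divide_eq)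
  qed
  show fin: "finite (A \<inter> cball x \<rho>)"
    using finite_if_finite_subsets_card_bdd[of "A \<inter> cball x \<rho>" "nat \<lfloor>((\<rho> + r) / r) ^ DIM('a)\<rfloor>"] bound
    by (simp add: le_nat_floor)
  show "real (card (A \<inter> cball x \<rho>)) \<le> ((\<rho> + r) / r) ^ DIM('a)"
    using bound[OF _ fin] by simp
qed

lemma delone_locally_finite:
  fixes A :: "'a::euclidean_space set"
  assumes "delone r R A" "0 < r"
  shows "finite (A \<inter> cball x \<rho>)"
  using delone_card_cball_le(1)[OF assms, of "\<bar>\<rho>\<bar>" x]
  by (rule rev_finite_subset) auto

lemma delone_countable:
  fixes A :: "'a::euclidean_space set"
  assumes "delone r R A" "0 < r"
  shows "countable A"
proof -
  have "countable (\<Union>n::nat. A \<inter> cball 0 (real n))"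
    by (rule countable_UN) (auto intro: countable_finite delone_locally_finite[OF assms])
  moreover have "A \<subseteq> (\<Union>n::nat. A \<inter> cball 0 (real n))"
    using real_arch_simple by fastforce
  ultimately show ?thesis by (rule countable_subset[rotated])
qed

text \<open>Centers spaced \<open>3 * R\<close> apart along a ray have disjoint balls of radius
  \<open>R\<close>, each containing a site. Linear growth is enough for exponential decay in
  \<open>t\<close> later.\<close>

lemma delone_card_cball_ge:
  fixes A :: "'a::euclidean_space set"
  assumes del: "delone r R A" and r: "0 < r" and R: "0 < R"
  shows "t \<le> card (A \<inter> cball x (3 * R * real t))"
proof -
  obtain e :: 'a where e: "norm e = 1" using vector_choose_size zero_le_one by blast
  define c where "c i = x + (3 * R * real i) *\<^sub>R e" for i :: nat
  have "\<exists>p. p \<in> A \<inter> cball (c i) R" for i using del unfolding delone_def by blast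
  then obtain p where p: "\<And>i. p i \<in> A \<inter> cball (c i) R" by metis
  have "inj p"
  proof (rule injI, rule ccontr)
    fix i j assume ij: "p i = p j" "i \<noteq> j"
    have "c i - c j = (3 * R * (real i - real j)) *\<^sub>R e"
      by (simp add: c_def algebra_simps)
    then have "dist (c i) (c j) = 3 * R * \<bar>real i - real j\<bar>"
      using e R by (simp add: dist_norm abs_mult)
    moreover have "\<bar>real i - real j\<bar> \<ge> 1" using ij by linarith
    ultimately have "dist (c i) (c j) \<ge> 3 * R * 1"
      using R by (metis mult_left_mono less_imp_le zero_less_mult_iff zero_less_numeral)
    moreover have "dist (c i) (c j) \<le> R + R"
      using p[of i] p[of j] ij dist_triangle_le[of "c i" "p i" "c j" "R + R"] by (simp add: dist_commute)
    ultimately show False using R by simp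
  qed
  moreover have "p ` {..<t} \<subseteq> A \<inter> cball x (3 * R * real t)"
  proof
    fix q assume "q \<in> p ` {..<t}"
    then obtain i where i: "i < t" "q = p i" by auto
    have "dist x (c i) = 3 * R * real i" using e R by (simp add: c_def dist_norm)
    then have "dist x q \<le> 3 * R * real i + R"
      using p[of i] i dist_triangle[of x q "c i"] by simp
    also have "\<dots> \<le> 3 * R * (real i + 1)" using R by (simp add: algebra_simps)
    also have "\<dots> \<le> 3 * R * real t" using R i by (intro mult_left_mono) auto
    finally show "q \<in> A \<inter> cball x (3 * R * real t)" using p i by auto
  qed
  ultimately have "card {..<t} \<le> card (A \<inter> cball x (3 * R * real t))"
    by (meson card_inj_on_le delone_locally_finite[OF del r] inj_on_subset subset_UNIV)
  then show ?thesis by simp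
qed

text \<open>A site within \<open>R\<close> of a point near the boundary may lie outside the ball.
  Pulling the point radially inward to norm at most \<open>\<omega> - R\<close> first avoids this,
  at the price of the radius \<open>2 * R\<close>.\<close>

lemma delone_cover_cball:
  fixes A :: "'a::euclidean_space set"
  assumes del: "delone r R A" and R: "0 < R" "R < \<omega>"
  shows "cball 0 \<omega> \<subseteq> (\<Union>a\<in>A \<inter> cball 0 \<omega>. cball a (2 * R))"
proof
  fix v :: 'a assume "v \<in> cball 0 \<omega>"
  then have v: "norm v \<le> \<omega>" by simp
  obtain v' where v': "norm v' \<le> \<omega> - R" "dist v v' \<le> R"
  proof (cases "norm v \<le> \<omega> - R")
    case True
    then show ?thesis using that[of v] R by simp
  next
    case False
    define l where "l = (\<omega> - R) / norm v"
    have nv: "norm v > 0" using False R by linarith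
    have l: "0 \<le> l" "l \<le> 1" "l * norm v = \<omega> - R" using False R nv by (auto simp: l_def)
    have "v - l *\<^sub>R v = (1 - l) *\<^sub>R v" by (simp add: algebra_simps)
    then have "dist v (l *\<^sub>R v) = (1 - l) * norm v"
      unfolding dist_norm using l(2) by (simp only: norm_scaleR abs_of_nonneg diff_ge_0_iff_ge)
    then have "dist v (l *\<^sub>R v) = norm v - (\<omega> - R)"
      by (simp only: left_diff_distrib l(3) mult_1)
    then show ?thesis using that[of "l *\<^sub>R v"] l v by simp
  qed
  obtain a where a: "a \<in> A" "dist v' a \<le> R" using del unfolding delone_def by fastforce
  have "norm a \<le> norm v' + dist v' a"
    using dist_triangle[of 0 a v'] by simp
  then have "norm a \<le> \<omega>" using v' a by linarith
  moreover have "dist a v \<le> 2 * R"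
    using v' a dist_triangle[of v a v'] by (simp add: dist_commute)
  ultimately show "v \<in> (\<Union>a\<in>A \<inter> cball 0 \<omega>. cball a (2 * R))" using a by auto
qed

section \<open>Events of a random coloring\<close>

lemma space_random_coloring: "space (random_coloring A J) = A \<rightarrow>\<^sub>E J"
  by (simp add: random_coloring_def space_PiM space_uniform_count_measure)

text \<open>There are finitely many color patterns on \<open>Q\<close>, so the event is a finite
  union of cylinder sets.\<close>

lemma random_coloring_finite_dependence_sets:
  assumes "finite Q" "Q \<subseteq> A" "finite J"
    and dep: "\<And>f g. \<lbrakk>f \<in> A \<rightarrow>\<^sub>E J; g \<in> A \<rightarrow>\<^sub>E J; \<And>a. a \<in> Q \<Longrightarrow> f a = g a; Pr f\<rbrakk> \<Longrightarrow> Pr g"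
  shows "{f \<in> space (random_coloring A J). Pr f} \<in> sets (random_coloring A J)"
proof -
  let ?P = "random_coloring A J"
  define W where "W = (\<lambda>f. restrict f Q) ` {f \<in> A \<rightarrow>\<^sub>E J. Pr f}"
  have "W \<subseteq> Q \<rightarrow>\<^sub>E J" using assms(2) by (auto simp: W_def)
  then have finW: "finite W" using assms by (meson finite_PiE finite_subset)
  have "{f \<in> space ?P. Pr f} = (\<Union>w\<in>W. {f \<in> space ?P. \<forall>a\<in>Q. f a \<in> {w a} \<inter> J})"
  proof (intro equalityI subsetI)
    fix f assume f: "f \<in> {f \<in> space ?P. Pr f}"
    then have "restrict f Q \<in> W" by (auto simp: W_def space_random_coloring)
    moreover have "f \<in> {f' \<in> space ?P. \<forall>a\<in>Q. f' a \<in> {restrict f Q a} \<inter> J}"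
      using f assms(2) by (auto simp: space_random_coloring)
    ultimately show "f \<in> (\<Union>w\<in>W. {f \<in> space ?P. \<forall>a\<in>Q. f a \<in> {w a} \<inter> J})" by blast
  next
    fix f assume "f \<in> (\<Union>w\<in>W. {f \<in> space ?P. \<forall>a\<in>Q. f a \<in> {w a} \<inter> J})"
    then obtain g where "g \<in> A \<rightarrow>\<^sub>E J" "Pr g" "f \<in> A \<rightarrow>\<^sub>E J" "\<forall>a\<in>Q. f a = g a"
      by (auto simp: W_def space_random_coloring)
    then show "f \<in> {f \<in> space ?P. Pr f}" using dep[of g f] by (auto simp: space_random_coloring)
  qed
  moreover have "{f \<in> space ?P. \<forall>a\<in>Q. f a \<in> {w a} \<inter> J} \<in> sets ?P" for w
  proof (rule sets.sets_Collect_finite_All[OF _ \<open>finite Q\<close>])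
    fix a assume "a \<in> Q"
    then have "(\<lambda>f. f a) \<in> measurable ?P (uniform_count_measure J)"
      unfolding random_coloring_def using assms(2) by (intro measurable_component_singleton) auto
    then have "(\<lambda>f. f a) -` ({w a} \<inter> J) \<inter> space ?P \<in> sets ?P"
      by (rule measurable_sets) (simp add: sets_uniform_count_measure)
    moreover have "(\<lambda>f. f a) -` ({w a} \<inter> J) \<inter> space ?P = {f \<in> space ?P. f a \<in> {w a} \<inter> J}"
      by blast
    ultimately show "{f \<in> space ?P. f a \<in> {w a} \<inter> J} \<in> sets ?P"
      by (simp only:)
  qed
  ultimately show ?thesis using finW by auto
qed

lemma emeasure_random_coloring_avoid:
  assumes Q: "finite Q" "Q \<subseteq> A" and J: "finite J" "j \<in> J"
  shows "emeasure (random_coloring A J) {f \<in> space (random_coloring A J). \<forall>a\<in>Q. f a \<noteq> j}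
    = ennreal ((1 - 1 / real (card J)) ^ card Q)"
proof -
  have "J \<noteq> {}" using J by auto
  have "prob_space (uniform_count_measure J)"
    using J \<open>J \<noteq> {}\<close> by (intro prob_space_uniform_count_measure)
  then interpret product_prob_space "\<lambda>_. uniform_count_measure J" A
    unfolding product_prob_space_def product_prob_space_axioms_def product_sigma_finite_def
    by (simp add: prob_space_imp_sigma_finite)
  have "{f \<in> space (random_coloring A J). \<forall>a\<in>Q. f a \<noteq> j} =
      {f \<in> space (random_coloring A J). \<forall>a\<in>Q. f a \<in> J - {j}}"
    using Q by (auto simp: space_random_coloring)
  also have "emeasure (random_coloring A J) \<dots> = (\<Prod>a\<in>Q. emeasure (uniform_count_measure J) (J - {j}))"
    unfolding random_coloring_def using Q
    by (intro emeasure_PiM_Collect) (auto simp: sets_uniform_count_measure)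
  also have "emeasure (uniform_count_measure J) (J - {j}) = ennreal (1 - 1 / real (card J))"
  proof -
    have "card J \<ge> 1" using J by (simp add: Suc_le_eq card_gt_0_iff \<open>J \<noteq> {}\<close>)
    then show ?thesis
      using J \<open>J \<noteq> {}\<close>
      by (simp add: emeasure_uniform_count_measure card_Diff_singleton of_nat_diff diff_divide_distrib)
  qed
  also have "(\<Prod>a\<in>Q. ennreal (1 - 1 / real (card J))) = ennreal ((1 - 1 / real (card J)) ^ card Q)"
  proof -
    have "card J \<ge> 1" using J by (simp add: Suc_le_eq card_gt_0_iff \<open>J \<noteq> {}\<close>)
    then have "0 \<le> 1 - 1 / real (card J)" by simp
    then show ?thesis by (simp add: ennreal_power)
  qed
  finally show ?thesis .
qed

lemma borel_measurable_num_cells_with_vertex_in: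
  fixes A :: "'a::euclidean_space set"
  assumes fin: "\<And>x \<rho>. finite (A \<inter> cball x \<rho>)" and "countable A" and J: "finite J" and \<omega>: "0 \<le> \<omega>"
  shows "(\<lambda>f. num_cells_with_vertex_in (cball x \<omega>) (Ovl J (\<lambda>j. Vor (color_class A f j))))
    \<in> borel_measurable (random_coloring A J)"
proof -
  let ?P = "random_coloring A J" and ?I = "{S. finite S \<and> S \<subseteq> A}"
  let ?X = "\<lambda>f. {S. indexes_cell_with_vertex_in A J f (cball x \<omega>) S}"
  have ev: "{f \<in> space ?P. indexes_cell_with_vertex_in A J f (cball x \<omega>) S} \<in> sets ?P" for S
  proof -
    \<comment> \<open>Until every color has been seen, no bounded set of sites need determine the
      event. On \<open>E t\<close> it depends only on the colors in one fixed ball, and the union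
      over \<open>t\<close> is countable.\<close>
    define E where "E t f \<longleftrightarrow> (\<forall>j\<in>J. \<exists>b\<in>A. f b = j \<and> dist x b \<le> real t)" for t :: nat and f
    have "{f \<in> space ?P. indexes_cell_with_vertex_in A J f (cball x \<omega>) S} =
      (\<Union>t. {f \<in> space ?P. E t f \<and> indexes_cell_with_vertex_in A J f (cball x \<omega>) S})"
    proof -
      have "\<exists>t. E t f" if f: "indexes_cell_with_vertex_in A J f (cball x \<omega>) S" for f
      proof -
        obtain a where a: "\<forall>j\<in>J. a j \<in> S \<and> f (a j) = j" and "S \<subseteq> A"
          using f nearest_sites_subset unfolding indexes_cell_with_vertex_in_def by blast
        obtain t :: nat where t: "Max (insert 0 ((\<lambda>j. dist x (a j)) ` J)) \<le> real t"
          using real_arch_simple by blast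
        have "dist x (a j) \<le> real t" if "j \<in> J" for j
          using t that J by (meson Max_ge finite_imageI finite_insert image_eqI insertI2 order_trans)
        then show ?thesis using a \<open>S \<subseteq> A\<close> unfolding E_def by blast
      qed
      then show ?thesis by blast
    qed
    moreover have "{f \<in> space ?P. E t f \<and> indexes_cell_with_vertex_in A J f (cball x \<omega>) S} \<in> sets ?P" for t
    proof (rule random_coloring_finite_dependence_sets[OF fin[of x "real t + 2 * (\<omega> + 1)"] _ J])
      fix f g assume fg: "f \<in> A \<rightarrow>\<^sub>E J" "g \<in> A \<rightarrow>\<^sub>E J"
        and eq: "\<And>a. a \<in> A \<inter> cball x (real t + 2 * (\<omega> + 1)) \<Longrightarrow> f a = g a"
        and f: "E t f \<and> indexes_cell_with_vertex_in A J f (cball x \<omega>) S"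
      have img: "f ` A \<subseteq> J" "g ` A \<subseteq> J" using fg by auto
      have "E t g"
        unfolding E_def
      proof
        fix j assume "j \<in> J"
        then obtain b where b: "b \<in> A" "f b = j" "dist x b \<le> real t" using f by (auto simp: E_def)
        moreover have "f b = g b" using b \<omega> by (intro eq) auto
        ultimately show "\<exists>b\<in>A. g b = j \<and> dist x b \<le> real t" by auto
      qed
      moreover have "indexes_cell_with_vertex_in A J g (cball x \<omega>) S"
        using f by (intro indexes_cell_with_vertex_in_local[OF img \<omega> _ eq]) (auto simp: E_def)
      ultimately show "E t g \<and> indexes_cell_with_vertex_in A J g (cball x \<omega>) S" ..
    qed auto
    ultimately show ?thesis by simp
  qed
  have cI: "countable ?I" using \<open>countable A\<close> by (rule countable_Collect_finite_subset)
  interpret sigma_finite_measure "count_space ?I"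
    using cI by (rule sigma_finite_measure_count_space_countable)
  \<comment> \<open>The index set is countable, so measurability of each single indicator gives
    joint measurability, and then that of the integral.\<close>
  have "(\<lambda>f. \<integral>\<^sup>+S. indicator (?X f) S \<partial>count_space ?I) \<in> borel_measurable ?P"
  proof (rule borel_measurable_nn_integral)
    have "(\<lambda>(S, f). indicator (?X f) S :: ennreal) \<in> borel_measurable (count_space ?I \<Otimes>\<^sub>M ?P)"
    proof (rule measurable_pair_measure_countable1[OF cI])
      fix S
      have "(\<lambda>f. indicator {f \<in> space ?P. indexes_cell_with_vertex_in A J f (cball x \<omega>) S} f :: ennreal)
          \<in> borel_measurable ?P"
        using ev[of S] by (rule borel_measurable_indicator)
      then show "(\<lambda>f. case (S, f) of (S, f) \<Rightarrow> (indicator (?X f) S :: ennreal)) \<in> borel_measurable ?P"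
        by (rule measurable_cong[THEN iffD1, rotated]) (simp add: indicator_def)
    qed
    then show "(\<lambda>(f, S). indicator (?X f) S :: ennreal) \<in> borel_measurable (?P \<Otimes>\<^sub>M count_space ?I)"
      by (subst measurable_pair_swap_iff) (simp add: case_prod_beta)
  qed
  moreover have "num_cells_with_vertex_in (cball x \<omega>) (Ovl J (\<lambda>j. Vor (color_class A f j))) =
      (\<integral>\<^sup>+S. indicator (?X f) S \<partial>count_space ?I)" if f: "f \<in> space ?P" for f
  proof -
    have img: "f ` A \<subseteq> J" using f by (auto simp: space_random_coloring)
    have sub: "?X f \<subseteq> ?I"
      using finite_nearest_sites[OF fin J img] nearest_sites_subset
      unfolding indexes_cell_with_vertex_in_def by blast
    have "num_cells_with_vertex_in (cball x \<omega>) (Ovl J (\<lambda>j. Vor (color_class A f j))) =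
        emeasure (count_space ?I) (?X f)"
      unfolding num_cells_with_vertex_in_eq[OF fin J img] using sub by (simp add: emeasure_count_space)
    also have "\<dots> = (\<integral>\<^sup>+S. indicator (?X f) S \<partial>count_space ?I)"
      using sub by (intro nn_integral_indicator[symmetric]) simp
    finally show ?thesis .
  qed
  ultimately show ?thesis by (subst measurable_cong) auto
qed


section \<open>Expected number of cells\<close>

text \<open>A union bound over the colors: at least \<open>t\<close> sites lie in the ball, each
  independently avoids a given color with probability \<open>1 - 1 / card J\<close>, and
  \<open>1 - u \<le> exp (- u)\<close>.\<close>

lemma emeasure_missing_color_le:
  fixes A :: "'a::euclidean_space set" and x :: 'a and t :: nat
  assumes del: "delone r R A" and "0 < r" "0 < R" and J: "finite J" "J \<noteq> {}"
  defines "M \<equiv> {f \<in> space (random_coloring A J). \<exists>j\<in>J. \<forall>a\<in>A \<inter> cball x (3 * R * real t). f a \<noteq> j}"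
  shows "M \<in> sets (random_coloring A J)"
    and "emeasure (random_coloring A J) M \<le> ennreal (card J * exp (- (real t / card J)))"
proof -
  let ?P = "random_coloring A J" and ?Q = "A \<inter> cball x (3 * R * real t)"
  have fin: "finite ?Q" using delone_locally_finite[OF del \<open>0 < r\<close>] .
  let ?E = "\<lambda>j. {f \<in> space ?P. \<forall>a\<in>?Q. f a \<noteq> j}"
  have sets: "?E j \<in> sets ?P" for j
    by (rule random_coloring_finite_dependence_sets[OF fin _ J(1)]) auto
  have M: "M = (\<Union>j\<in>J. ?E j)" by (auto simp: M_def)
  show "M \<in> sets ?P" unfolding M using J(1) sets by (rule sets.finite_UN)
  have "card J \<ge> 1" using J by (simp add: Suc_le_eq card_gt_0_iff)
  then have q: "0 \<le> 1 - 1 / real (card J)" "1 - 1 / real (card J) \<le> 1" by auto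
  have E: "emeasure ?P (?E j) \<le> ennreal (exp (- (real t / card J)))" if "j \<in> J" for j
  proof -
    have "emeasure ?P (?E j) = ennreal ((1 - 1 / real (card J)) ^ card ?Q)"
      using that by (intro emeasure_random_coloring_avoid[OF fin _ J(1)]) auto
    also have "(1 - 1 / real (card J)) ^ card ?Q \<le> (1 - 1 / real (card J)) ^ t"
      using delone_card_cball_ge[OF del \<open>0 < r\<close> \<open>0 < R\<close>] q by (intro power_decreasing) auto
    also have "\<dots> \<le> exp (- (1 / real (card J))) ^ t"
      using q exp_ge_add_one_self[of "- (1 / real (card J))"] by (intro power_mono) auto
    also have "\<dots> = exp (- (real t / card J))"
      by (simp add: exp_of_nat_mult[symmetric])
    finally show ?thesis by (simp add: ennreal_leI)
  qed
  have "emeasure ?P M \<le> (\<Sum>j\<in>J. emeasure ?P (?E j))"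
    unfolding M using J(1) sets by (intro emeasure_subadditive_finite) auto
  also have "\<dots> \<le> (\<Sum>j\<in>J. ennreal (exp (- (real t / card J))))"
    using E by (rule sum_mono)
  also have "\<dots> = ennreal (card J * exp (- (real t / card J)))"
    by (simp add: ennreal_mult' ennreal_of_nat_eq_real_of_nat)
  finally show "emeasure ?P M \<le> ennreal (card J * exp (- (real t / card J)))" .
qed

text \<open>Half of the decay rate absorbs the polynomial; the other half leaves a geometric
  series.\<close>

lemma summable_poly_times_exp:
  fixes \<alpha> \<beta> c :: real
  assumes "\<alpha> > 0" "c > 0" "\<beta> > 0"
  shows "summable (\<lambda>t::nat. (\<alpha> * t + \<beta>) ^ m * exp (- c * t))"
proof (rule summable_comparison_test_bigo)
  show "(\<lambda>t::nat. (\<alpha> * t + \<beta>) ^ m * exp (- c * t)) \<in> O(\<lambda>t. exp (- (c / 2) * t))"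
    using assms by real_asymp
  have "(\<lambda>t::nat. norm (exp (- (c / 2) * t))) = (\<lambda>t. exp (- (c / 2)) ^ t)"
    by (rule ext) (simp add: exp_of_nat_mult[symmetric] mult_ac)
  then show "summable (\<lambda>t::nat. norm (exp (- (c / 2) * t)))"
    using assms by (simp add: summable_geometric)
qed

text \<open>Summing over the first radius \<open>3 R t\<close> at which all colors are seen from \<open>x\<close>: the number of
  cells is then polynomial in \<open>t\<close>, while the probability of needing radius \<open>3 R t\<close> decays
  exponentially.\<close>

lemma expected_num_cells_with_vertex_in_cball_le:
  fixes J :: "'j set"
  assumes "0 < r" "0 < R" and J: "finite J" "J \<noteq> {}"
  shows "\<exists>C>0. \<forall>(A :: 'a::euclidean_space set) x. delone r R A \<longrightarrow>
    (\<integral>\<^sup>+f. num_cells_with_vertex_in (cball x (2 * R)) (Ovl J (\<lambda>j. Vor (color_class A f j)))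
      \<partial>random_coloring A J) \<le> ennreal C"
proof -
  define k where "k = DIM('a) + card J"
  \<comment> \<open>For radius \<open>3 * R * t + 4 * R\<close> the packing bound has base
    \<open>\<alpha> * t + \<beta> - 1\<close>. The extra 1 in \<open>\<beta>\<close> makes the base
    at least 1, so adding 1 to the number of sites at most doubles the bound, whence
    \<open>2 ^ k\<close> in \<open>c\<close>.\<close>
  define \<alpha> \<beta> where "\<alpha> = 3 * R / r" and "\<beta> = (4 * R + r) / r + 1"
  define c where "c t = (k + 1) * 2 ^ k * (\<alpha> * real t + \<beta>) ^ (DIM('a) * k)" for t :: nat
  \<comment> \<open>\<open>p t\<close> is to bound the probability that no index below
    \<open>t\<close> gives a sufficient radius, which for positive \<open>t\<close> means failure at
    \<open>t - 1\<close>; the factor \<open>exp (1 / card J)\<close> pays for this shift, and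
    \<open>p 0\<close> is at least 1.\<close>
  define p where "p t = card J * exp (1 / card J) * exp (- (1 / card J) * real t)" for t :: nat
  have \<alpha>\<beta>: "\<alpha> > 0" "\<beta> > 0" using assms by (auto simp: \<alpha>_def \<beta>_def intro!: add_pos_pos)
  have cardJ: "card J \<ge> 1" using J by (simp add: Suc_le_eq card_gt_0_iff)
  have c0: "c t \<ge> 0" and p0: "p t \<ge> 0" for t using \<alpha>\<beta> by (auto simp: c_def p_def)
  have "summable (\<lambda>t. ((k + 1) * 2 ^ k * card J * exp (1 / card J)) *
      ((\<alpha> * real t + \<beta>) ^ (DIM('a) * k) * exp (- (1 / card J) * real t)))"
    using \<alpha>\<beta> cardJ by (intro summable_mult summable_poly_times_exp) auto
  then have sm: "summable (\<lambda>t. c t * p t)"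
    by (simp add: c_def p_def mult_ac)
  \<comment> \<open>The 1 makes \<open>C\<close> positive; nothing in the sum depends on
    \<open>A\<close> or \<open>x\<close>.\<close>
  define C where "C = (\<Sum>t. c t * p t) + 1"
  have "(\<integral>\<^sup>+f. num_cells_with_vertex_in (cball x (2 * R)) (Ovl J (\<lambda>j. Vor (color_class A f j)))
      \<partial>random_coloring A J) \<le> ennreal C" if del: "delone r R A" for A :: "'a set" and x
  proof -
    let ?P = "random_coloring A J"
    let ?N = "\<lambda>f. num_cells_with_vertex_in (cball x (2 * R)) (Ovl J (\<lambda>j. Vor (color_class A f j)))"
    have fin: "finite (A \<inter> cball y \<rho>)" for y \<rho> using delone_locally_finite[OF del \<open>0 < r\<close>] .
    define seen where "seen f t \<longleftrightarrow> (\<forall>j\<in>J. \<exists>b\<in>A. f b = j \<and> dist x b \<le> 3 * R * real t)"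
      for f :: "'a \<Rightarrow> 'j" and t :: nat
    define B where "B t = {f \<in> space ?P. \<forall>i<t. \<not> seen f i}" for t
    \<comment> \<open>Seeing all colors is monotone in the radius, so failure at every index up to
      \<open>t\<close> is failure at \<open>t\<close>.\<close>
    have B_Suc: "B (Suc t) = {f \<in> space ?P. \<exists>j\<in>J. \<forall>a\<in>A \<inter> cball x (3 * R * real t). f a \<noteq> j}" for t
    proof -
      have "seen f t" if "seen f i" "i < Suc t" for f i
      proof -
        have "3 * R * real i \<le> 3 * R * real t" using that \<open>0 < R\<close> by (intro mult_left_mono) auto
        then show ?thesis using that(1) unfolding seen_def by (meson order_trans)
      qed
      then have "B (Suc t) = {f \<in> space ?P. \<not> seen f t}" by (auto simp: B_def)
      moreover have "\<not> seen f t \<longleftrightarrow> (\<exists>j\<in>J. \<forall>a\<in>A \<inter> cball x (3 * R * real t). f a \<noteq> j)" for f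
        unfolding seen_def Ball_def Bex_def Int_iff mem_cball by metis
      ultimately show ?thesis by simp
    qed
    interpret P: prob_space ?P
      unfolding random_coloring_def using J by (intro prob_space_PiM prob_space_uniform_count_measure)
    have B: "B t \<in> sets ?P \<and> emeasure ?P (B t) \<le> ennreal (p t)" for t
    proof (cases t)
      case 0
      have "1 * 1 \<le> real (card J) * exp (1 / card J)" using cardJ by (intro mult_mono) auto
      then show ?thesis using 0 by (simp add: B_def p_def P.emeasure_space_1)
    next
      case (Suc i)
      have "p t = card J * exp (- (real i / card J))"
        by (simp add: p_def Suc exp_add[symmetric] add_divide_distrib field_simps flip: exp_minus)
      then show ?thesis
        using emeasure_missing_color_le[OF del assms, of x i] unfolding Suc B_Suc by simp
    qed
    have bound: "?N f \<le> (\<Sum>t. ennreal (c t) * indicator (B t) f)" if f: "f \<in> space ?P" for f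
    proof (cases "\<exists>t. seen f t")
      case True
      \<comment> \<open>The single term at the first sufficient index already dominates the
        count.\<close>
      define t where "t = (LEAST t. seen f t)"
      have seen: "seen f t" and "\<forall>i<t. \<not> seen f i"
        using True unfolding t_def by (auto intro: LeastI dest: not_less_Least)
      then have fB: "f \<in> B t" using f by (auto simp: B_def)
      have img: "f ` A \<subseteq> J" using f by (auto simp: space_random_coloring)
      let ?m = "card (A \<inter> cball x (3 * R * real t + 2 * (2 * R)))"
      have "?N f \<le> of_nat ((k + 1) * (?m + 1) ^ k)"
        unfolding k_def using seen unfolding seen_def
        by (intro num_cells_with_vertex_in_cball_le[OF fin J(1) img]) blast
      also have "\<dots> = ennreal (real ((k + 1) * (?m + 1) ^ k))"
        by (simp only: ennreal_of_nat_eq_real_of_nat)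
      also have "\<dots> \<le> ennreal (c t)"
      proof (rule ennreal_leI)
        define b where "b = \<alpha> * real t + \<beta> - 1"
        have b: "b \<ge> 0" "b = (3 * R * real t + 2 * (2 * R) + r) / r"
          using assms by (auto simp: b_def \<alpha>_def \<beta>_def field_simps)
        have "real ?m \<le> b ^ DIM('a)"
          unfolding b(2) using assms by (intro delone_card_cball_le(2)[OF del]) auto
        also have "\<dots> \<le> (b + 1) ^ DIM('a)" using b by (intro power_mono) auto
        finally have "real ?m \<le> (b + 1) ^ DIM('a)" .
        moreover have "1 \<le> (b + 1) ^ DIM('a)" using b(1) by (intro one_le_power) simp
        ultimately have "real (?m + 1) \<le> 2 * (b + 1) ^ DIM('a)" by linarith
        then have "real (?m + 1) ^ k \<le> (2 * (b + 1) ^ DIM('a)) ^ k"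
          by (intro power_mono) auto
        also have "\<dots> = 2 ^ k * (\<alpha> * real t + \<beta>) ^ (DIM('a) * k)"
          by (simp add: b_def power_mult_distrib power_mult)
        finally have "real (k + 1) * real (?m + 1) ^ k
            \<le> real (k + 1) * (2 ^ k * (\<alpha> * real t + \<beta>) ^ (DIM('a) * k))"
          by (intro mult_left_mono) auto
        then show "real ((k + 1) * (?m + 1) ^ k) \<le> c t"
          by (simp only: c_def of_nat_mult of_nat_power of_nat_numeral mult.assoc)
      qed
      also have "\<dots> = (\<Sum>i\<in>{t}. ennreal (c i) * indicator (B i) f)" using fB by simp
      also have "\<dots> \<le> (\<Sum>i. ennreal (c i) * indicator (B i) f)"
        by (intro sum_le_suminf) auto
      finally show ?thesis .
    next
      case False
      \<comment> \<open>Some color does not occur at all, so the overlay is empty; the bound thus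
        holds for every coloring, not only almost every one.\<close>
      have "overlay_top_cells J (\<lambda>j. Vor (color_class A f j)) = {}"
      proof (rule ccontr)
        assume "overlay_top_cells J (\<lambda>j. Vor (color_class A f j)) \<noteq> {}"
        then obtain a where a: "\<forall>j\<in>J. a j \<in> A \<and> f (a j) = j"
          using overlay_top_cells_Vor_iff[where J = J and A = A and f = f] by blast
        obtain t :: nat where t: "Max ((\<lambda>j. dist x (a j)) ` J) < real t * (3 * R)"
          using reals_Archimedean3[of "3 * R"] \<open>0 < R\<close> by auto
        have "dist x (a j) \<le> 3 * R * real t" if "j \<in> J" for j
          using t that J by (auto simp: mult_ac intro: less_imp_le)
        then have "seen f t" using a unfolding seen_def by blast
        then show False using False by blast
      qed
      then show ?thesis by (simp add: num_cells_with_vertex_in_def Ovl_def)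
    qed
    have [measurable]: "B t \<in> sets ?P" for t using B by blast
    have "(\<integral>\<^sup>+f. ?N f \<partial>?P) \<le> (\<integral>\<^sup>+f. (\<Sum>t. ennreal (c t) * indicator (B t) f) \<partial>?P)"
      using bound by (rule nn_integral_mono)
    also have "\<dots> = (\<Sum>t. \<integral>\<^sup>+f. ennreal (c t) * indicator (B t) f \<partial>?P)"
      by (intro nn_integral_suminf) measurable
    also have "\<dots> = (\<Sum>t. ennreal (c t) * emeasure ?P (B t))"
      using B by (simp add: nn_integral_cmult_indicator)
    also have "\<dots> \<le> (\<Sum>t. ennreal (c t * p t))"
      using B c0 p0 by (intro suminf_le) (auto simp: ennreal_mult intro!: mult_left_mono)
    also have "\<dots> = ennreal (\<Sum>t. c t * p t)"
      using c0 p0 sm by (intro suminf_ennreal2) auto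
    also have "\<dots> \<le> ennreal C" by (intro ennreal_leI) (simp add: C_def)
    finally show ?thesis .
  qed
  moreover have "C > 0"
    using suminf_nonneg[OF sm] c0 p0 by (simp add: C_def add_nonneg_pos)
  ultimately show ?thesis by blast
qed

text \<open>Measurability is part of the conclusion because \<open>nn_integral\<close> of a
  non-measurable function would be only a supremum over simple functions below it, not an
  expectation.\<close>

theorem mainTheorem8:
  fixes s :: nat and r R :: real
  assumes "0 < r" and "r < R"
  shows "\<exists>C>0. \<forall>(A :: (real ^ 'd) set) (\<omega> :: real).
    delone r R A \<and> R < \<omega> \<longrightarrow>
      (let \<sigma> = {0..s};
           \<Omega> = cball 0 \<omega>;
           n = card (A \<inter> \<Omega>);
           P = random_coloring A \<sigma>;
           N = (\<lambda>f. num_cells_with_vertex_in \<Omega> (Ovl \<sigma> (\<lambda>j. Vor (color_class A f j))))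
       in N \<in> borel_measurable P \<and> (\<integral>\<^sup>+ f. N f \<partial>P) \<le> ennreal (C * real n))"
proof -
  have R: "0 < R" using assms by simp
  let ?J = "{0..s}"
  obtain C where C: "C > 0" "\<And>(A :: (real ^ 'd) set) x. delone r R A \<Longrightarrow>
      (\<integral>\<^sup>+f. num_cells_with_vertex_in (cball x (2 * R)) (Ovl ?J (\<lambda>j. Vor (color_class A f j)))
        \<partial>random_coloring A ?J) \<le> ennreal C"
    using expected_num_cells_with_vertex_in_cball_le[OF assms(1) R, of ?J, where 'a = "real ^ 'd"] by auto
  show ?thesis
    unfolding Let_def
  proof (intro exI[of _ C] conjI allI impI C(1))
    fix A :: "(real ^ 'd) set" and \<omega> :: real
    assume A\<omega>: "delone r R A \<and> R < \<omega>"
    let ?P = "random_coloring A ?J" and ?Q = "A \<inter> cball 0 \<omega>"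
    let ?N = "\<lambda>\<Omega> f. num_cells_with_vertex_in \<Omega> (Ovl ?J (\<lambda>j. Vor (color_class A f j)))"
    have fin: "finite (A \<inter> cball y \<rho>)" for y \<rho> using delone_locally_finite A\<omega> assms(1) by blast
    have meas: "?N (cball x \<rho>) \<in> borel_measurable ?P" if "\<rho> \<ge> 0" for x \<rho>
      using delone_countable A\<omega> assms(1) that
      by (intro borel_measurable_num_cells_with_vertex_in[OF fin]) auto
    show "?N (cball 0 \<omega>) \<in> borel_measurable ?P" using A\<omega> R by (intro meas) simp
    \<comment> \<open>A cell with a vertex in the large ball has that vertex in one of the covering
      balls; counting it several times only increases the right side.\<close>
    have "?N (cball 0 \<omega>) f \<le> (\<Sum>a\<in>?Q. ?N (cball a (2 * R)) f)" for f
    proof -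
      let ?K = "Ovl ?J (\<lambda>j. Vor (color_class A f j))"
      have "{F \<in> ?K. \<exists>v\<in>cball 0 \<omega>. v extreme_point_of F} \<subseteq>
          (\<Union>a\<in>?Q. {F \<in> ?K. \<exists>v\<in>cball a (2 * R). v extreme_point_of F})"
        using delone_cover_cball[of r R A \<omega>] A\<omega> R by blast
      then have "?N (cball 0 \<omega>) f \<le> emeasure (count_space UNIV)
          (\<Union>a\<in>?Q. {F \<in> ?K. \<exists>v\<in>cball a (2 * R). v extreme_point_of F})"
        unfolding num_cells_with_vertex_in_def by (intro emeasure_mono) auto
      also have "\<dots> \<le> (\<Sum>a\<in>?Q. ?N (cball a (2 * R)) f)"
        unfolding num_cells_with_vertex_in_def using fin by (intro emeasure_subadditive_finite) auto
      finally show ?thesis .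
    qed
    then have "(\<integral>\<^sup>+f. ?N (cball 0 \<omega>) f \<partial>?P) \<le> (\<integral>\<^sup>+f. (\<Sum>a\<in>?Q. ?N (cball a (2 * R)) f) \<partial>?P)"
      by (intro nn_integral_mono)
    also have "\<dots> = (\<Sum>a\<in>?Q. \<integral>\<^sup>+f. ?N (cball a (2 * R)) f \<partial>?P)"
      using R by (intro nn_integral_sum meas) simp
    also have "\<dots> \<le> (\<Sum>a\<in>?Q. ennreal C)"
      using C(2) A\<omega> by (intro sum_mono) blast
    also have "\<dots> = ennreal (C * real (card ?Q))"
      using C(1) by (simp add: ennreal_mult' ennreal_of_nat_eq_real_of_nat mult.commute)
    finally show "(\<integral>\<^sup>+f. ?N (cball 0 \<omega>) f \<partial>?P) \<le> ennreal (C * real (card ?Q))" .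
  qed
qed

end
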